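(* Let $X$ be a reflexive Banach space, let $F\subseteq X$ be a closed convex set with $0\in F$, and let $Q\subseteq X$ be a nonempty closed bounded convex set. For $\bar x\notin Q-F_\infty$ with $\mathcal{T}^F_Q(\bar x)<\infty$, one has $$\partial\mathcal{T}^F_Q(\bar x)=N(\bar x;Q_r)\cap S^*,$$ where $$S^*=\{x^*\in X^*: \sigma_F(-x^* )=1\}\quad\text{and}\quad r=\mathcal{T}^F_Q(\bar x)>0.$$
   Context: Normed spaces are real; $X^*$ is the dual of $X$ and $\langle x^*,x\rangle=x^*(x)$. For $t\ge 0$, $tF=\{tf: f\in F\}$ (so $0F=\{0\}$), and $\inf\emptyset=\infty$. The minimal time function is $\mathcal{T}^F_Q(x)=\inf\{t\ge 0: (x+tF)\cap Q\ne\emptyset\}\in[0,\infty]$. For $r>0$, $Q_r=\{x\in X: \mathcal{T}^F_Q(x)\le r\}$. The asymptotic cone of $F$ is $F_\infty=\{d\in X: x+td\in F \text{ for all } t>0\}$, where $x\in F$ is any point (the set does not depend on the choice of $x\in F$). $\sigma_F(x^* )=\sup\{\langle x^*,f\rangle: f\in F\}$. For a convex $\varphi:X\to(-\infty,\infty]$ and $\bar x$ with $\varphi(\bar x)<\infty$, $\partial\varphi(\bar x)=\{x^*\in X^*: \langle x^*,x-\bar x\rangle\le\varphi(x)-\varphi(\bar x)\text{ for all }x\in X\}$. For a convex set $A$ and $\bar x\in A$, $N(\bar x;A)=\{x^*\in X^*: \langle x^*,x-\bar x\rangle\le 0\text{ for all }x\in A\}$. *)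

theory Defs
  imports "HOL-Analysis.Analysis"
begin

text \<open>The dual of \<open>'a\<close> is the space \<open>'a \<Rightarrow>\<^sub>L real\<close> of bounded linear functionals.\<close>

definition bidual_embedding :: "'a::real_normed_vector \<Rightarrow> (('a \<Rightarrow>\<^sub>L real) \<Rightarrow>\<^sub>L real)" where
  "bidual_embedding x = Blinfun (\<lambda>f. blinfun_apply f x)"

lemma bidual_embedding_apply [simp]:
  "blinfun_apply (bidual_embedding x) f = blinfun_apply f x"
  by (simp add: bidual_embedding_def bounded_linear_Blinfun_apply
      blinfun.bounded_linear_left)

definition reflexive_space :: "'a::real_normed_vector itself \<Rightarrow> bool" where
  "reflexive_space _ \<longleftrightarrow> surj (bidual_embedding :: 'a \<Rightarrow> (('a \<Rightarrow>\<^sub>L real) \<Rightarrow>\<^sub>L real))"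

text \<open>In \<open>ereal\<close> the infimum of the empty set is \<open>\<infinity>\<close>, as required.\<close>

definition minimal_time :: "'a::real_normed_vector set \<Rightarrow> 'a set \<Rightarrow> 'a \<Rightarrow> ereal" where
  "minimal_time F Q x =
     Inf {ereal t | t. t \<ge> 0 \<and> ((\<lambda>f. x + t *\<^sub>R f) ` F) \<inter> Q \<noteq> {}}"

definition enlargement :: "'a::real_normed_vector set \<Rightarrow> 'a set \<Rightarrow> real \<Rightarrow> 'a set" where
  "enlargement F Q r = {x. minimal_time F Q x \<le> ereal r}"

text \<open>For closed convex \<open>F\<close> the base point \<open>x\<close> is irrelevant; see
  \<open>asymptotic_cone_eq\<close> below.\<close>

definition asymptotic_cone :: "'a::real_normed_vector set \<Rightarrow> 'a set" where
  "asymptotic_cone F = {d. \<exists>x\<in>F. \<forall>t>0. x + t *\<^sub>R d \<in> F}"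

lemma asymptotic_cone_eq:
  fixes F :: "'a::real_normed_vector set"
  assumes "closed F" "convex F" and y: "y \<in> F"
  shows "asymptotic_cone F = {d. \<forall>t>0. y + t *\<^sub>R d \<in> F}"
proof -
  have "y + t *\<^sub>R d \<in> F" if x: "x \<in> F" "\<forall>t>0. x + t *\<^sub>R d \<in> F" and t: "t > 0" for x d t
  proof -
    define z where "z n = y + (1 / real (Suc n)) *\<^sub>R (x - y) + t *\<^sub>R d" for n
    have "z n \<in> F" for n
    proof -
      let ?c = "1 / real (Suc n)"
      have "x + (real (Suc n) * t) *\<^sub>R d \<in> F"
        using x t by simp
      then have "(1 - ?c) *\<^sub>R y + ?c *\<^sub>R (x + (real (Suc n) * t) *\<^sub>R d) \<in> F"
        using \<open>convex F\<close> y by (intro convexD) auto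
      moreover have "?c *\<^sub>R (x + (real (Suc n) * t) *\<^sub>R d) = ?c *\<^sub>R x + t *\<^sub>R d"
        by (simp add: scaleR_right_distrib del: of_nat_Suc)
      ultimately show ?thesis
        by (simp add: z_def algebra_simps del: of_nat_Suc)
    qed
    moreover have "z \<longlonglongrightarrow> y + 0 *\<^sub>R (x - y) + t *\<^sub>R d"
      unfolding z_def by (intro tendsto_intros LIMSEQ_Suc lim_1_over_n)
    ultimately show ?thesis
      using \<open>closed F\<close> by (auto dest: closed_sequentially)
  qed
  then show ?thesis
    using y by (auto simp: asymptotic_cone_def)
qed

definition support_fun :: "'a::real_normed_vector set \<Rightarrow> ('a \<Rightarrow>\<^sub>L real) \<Rightarrow> ereal" where
  "support_fun F u = (SUP f\<in>F. ereal (blinfun_apply u f))"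

text \<open>Meant for \<open>\<phi>\<close> with values in \<open>(-\<infinity>, \<infinity>]\<close> and \<open>\<phi> xbar < \<infinity>\<close>, so that the
  difference is never of the form \<open>\<infinity> - \<infinity>\<close>.\<close>

definition subdifferential ::
    "('a::real_normed_vector \<Rightarrow> ereal) \<Rightarrow> 'a \<Rightarrow> ('a \<Rightarrow>\<^sub>L real) set" where
  "subdifferential \<phi> xbar =
     {u. \<forall>x. ereal (blinfun_apply u (x - xbar)) \<le> \<phi> x - \<phi> xbar}"

definition normal_cone ::
    "'a::real_normed_vector \<Rightarrow> 'a set \<Rightarrow> ('a \<Rightarrow>\<^sub>L real) set" where
  "normal_cone xbar A = {u. \<forall>x\<in>A. blinfun_apply u (x - xbar) \<le> 0}"

definition S_star :: "'a::real_normed_vector set \<Rightarrow> ('a \<Rightarrow>\<^sub>L real) set" where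
  "S_star F = {u. support_fun F (- u) = 1}"

end

theory Submission
  imports Defs
begin

text \<open>Positivity of \<open>r\<close> is the only place where reflexivity enters. If \<open>r = 0\<close>, the sets
  \<open>{q \<in> Q. n (q - xbar) \<in> F}\<close> form a decreasing sequence of nonempty bounded closed convex sets;
  in a reflexive space they have a common point \<open>q\<close>, and then \<open>q - xbar\<close> lies in the asymptotic
  cone of \<open>F\<close>. The common point represents a linear functional on the dual that is dominated by
  the sublinear functional \<open>u \<mapsto> inf\<^sub>n sup\<^bsub>C n\<^esub> u\<close>.

  The formula for the subdifferential rests on the inequality \<open>T (x - s f) \<le> T x + s\<close> for
  \<open>f \<in> F\<close>, \<open>s \<ge> 0\<close>, and on near-optimal representations \<open>x + t f \<in> Q\<close>.\<close>

section \<open>Sublinear functionals and the Hahn--Banach theorem\<close>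

definition sublinear :: "('a::real_vector \<Rightarrow> real) \<Rightarrow> bool" where
  "sublinear p \<longleftrightarrow> (\<forall>x y. p (x + y) \<le> p x + p y) \<and> (\<forall>c\<ge>0. \<forall>x. p (c *\<^sub>R x) = c * p x)"

lemma sublinear_add: "sublinear p \<Longrightarrow> p (x + y) \<le> p x + p y"
  by (simp add: sublinear_def)

lemma sublinear_scale: "sublinear p \<Longrightarrow> c \<ge> 0 \<Longrightarrow> p (c *\<^sub>R x) = c * p x"
  by (simp add: sublinear_def)

lemma sublinear_zero: "sublinear p \<Longrightarrow> p 0 = 0"
  using sublinear_scale[of p 0 0] by simp

lemma sublinear_minus: "sublinear p \<Longrightarrow> - p (- x) \<le> p x"
  using sublinear_add[of p x "- x"] sublinear_zero[of p] by simp

text \<open>The members \<open>A i\<close> need not be sublinear themselves, and an infimum of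
  sublinear functionals need not be subadditive. What is needed is that sums and positive multiples
  of values are matched by another index, which may depend on the arguments; \<open>lower\<close>
  keeps the infimum finite.\<close>

lemma sublinear_INF:
  fixes A :: "'i \<Rightarrow> 'a::real_vector \<Rightarrow> real"
  assumes ne: "I \<noteq> {}"
    and lower: "\<And>i x. i \<in> I \<Longrightarrow> b x \<le> A i x"
    and add: "\<And>i j x y. i \<in> I \<Longrightarrow> j \<in> I \<Longrightarrow> \<exists>k\<in>I. A k (x + y) \<le> A i x + A j y"
    and scale: "\<And>i c x. i \<in> I \<Longrightarrow> c > 0 \<Longrightarrow> \<exists>k\<in>I. A k (c *\<^sub>R x) \<le> c * A i x"
    and zero: "\<exists>i\<in>I. A i 0 \<le> 0"
  shows "sublinear (\<lambda>x. INF i\<in>I. A i x)"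
proof -
  define p where "p x = (INF i\<in>I. A i x)" for x
  have bdd: "bdd_below ((\<lambda>i. A i x) ` I)" for x
    using lower by (intro bdd_belowI2)
  have le: "p x \<le> A i x" if "i \<in> I" for i x
    unfolding p_def using bdd that by (rule cINF_lower)
  have ge: "m \<le> p x" if "\<And>i. i \<in> I \<Longrightarrow> m \<le> A i x" for m x
    unfolding p_def using ne that by (rule cINF_greatest)
  have sub: "p (x + y) \<le> p x + p y" for x y
  proof -
    have "p (x + y) - A i x \<le> p y" if i: "i \<in> I" for i
    proof (rule ge)
      fix j assume j: "j \<in> I"
      obtain k where "k \<in> I" "A k (x + y) \<le> A i x + A j y"
        using add[OF i j] by blast
      then show "p (x + y) - A i x \<le> A j y"
        using le[of k "x + y"] by linarith
    qed
    then have "p (x + y) - p y \<le> p x"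
      by (intro ge) (simp add: algebra_simps)
    then show ?thesis by simp
  qed
  have sc: "p (c *\<^sub>R x) \<le> c * p x" if c: "c > 0" for c x
  proof -
    have "p (c *\<^sub>R x) / c \<le> p x"
    proof (rule ge)
      fix i assume i: "i \<in> I"
      obtain k where "k \<in> I" "A k (c *\<^sub>R x) \<le> c * A i x"
        using scale[OF i c] by blast
      then show "p (c *\<^sub>R x) / c \<le> A i x"
        using le[of k "c *\<^sub>R x"] c by (simp add: field_simps)
    qed
    then show ?thesis using c by (simp add: field_simps)
  qed
  have sc': "p (c *\<^sub>R x) = c * p x" if c: "c > 0" for c x
  proof (rule antisym[OF sc[OF c]])
    \<comment> \<open>The reverse inequality is \<open>sc\<close> with factor
      \<open>inverse c\<close> at the scaled point.\<close>
    have "p x \<le> inverse c * p (c *\<^sub>R x)"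
      using sc[of "inverse c" "c *\<^sub>R x"] c by simp
    then show "c * p x \<le> p (c *\<^sub>R x)" using c by (simp add: field_simps)
  qed
  have "p 0 = 0"
  proof (rule antisym)
    show "p 0 \<le> 0" using zero le order_trans by blast
    show "0 \<le> p 0" using sub[of 0 0] by simp
  qed
  with sub sc' have "sublinear p"
    unfolding sublinear_def by (metis less_eq_real_def mult_zero_left scaleR_zero_left)
  then show ?thesis by (simp add: p_def[abs_def])
qed

text \<open>The functional \<open>x \<mapsto> inf\<^bsub>t \<ge> 0\<^esub> (q (x + t y) - t q y)\<close> is sublinear, lies below \<open>q\<close>, and
  its value at \<open>- y\<close> is at most \<open>- q y\<close>.\<close>

lemma minimal_sublinear_linear:
  fixes q :: "'a::real_vector \<Rightarrow> real"
  assumes q: "sublinear q"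
    and min: "\<And>p. sublinear p \<Longrightarrow> p \<le> q \<Longrightarrow> p = q"
  shows "linear q"
proof -
  have neg: "q (- y) = - q y" for y
  proof -
    define A where "A t x = q (x + t *\<^sub>R y) - t * q y" for t x
    define p where "p x = (INF t\<in>{0..}. A t x)" for x
    \<comment> \<open>Subadditivity for \<open>(x + t y) + (- x) = t y\<close> gives a bound
      independent of \<open>t\<close>.\<close>
    have lower: "- q (- x) \<le> A t x" if "t \<ge> 0" for t x
      using sublinear_add[OF q, of "x + t *\<^sub>R y" "- x"] sublinear_scale[OF q that, of y]
      by (simp add: A_def)
    have "sublinear p"
      unfolding p_def[abs_def]
    proof (rule sublinear_INF)
      show "- q (- x) \<le> A t x" if "t \<in> {0..}" for t x
        using lower that by simp
      show "\<exists>k\<in>{0..}. A k (x + z) \<le> A s x + A t z" if "s \<in> {0..}" "t \<in> {0..}" for s t x z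
        using that sublinear_add[OF q, of "x + s *\<^sub>R y" "z + t *\<^sub>R y"]
        by (intro bexI[of _ "s + t"]) (auto simp: A_def algebra_simps)
      show "\<exists>k\<in>{0..}. A k (c *\<^sub>R x) \<le> c * A t x" if "t \<in> {0..}" "c > 0" for t c x
        using that sublinear_scale[OF q, of c "x + t *\<^sub>R y"]
        by (intro bexI[of _ "c * t"]) (auto simp: A_def algebra_simps)
      show "\<exists>t\<in>{0..}. A t 0 \<le> 0"
        by (intro bexI[of _ 0]) (auto simp: A_def sublinear_zero[OF q])
    qed auto
    moreover have le: "p x \<le> A t x" if "t \<ge> 0" for t x
      unfolding p_def using that lower
      by (intro cINF_lower bdd_belowI2[where m = "- q (- x)"]) auto
    then have "p \<le> q"
      by (auto simp: le_fun_def A_def dest: spec[of _ 0] intro: order_trans[OF le[of 0]])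
    ultimately have "p = q" by (rule min)
    then have "q (- y) \<le> - q y"
      using le[of 1 "- y"] by (simp add: A_def sublinear_zero[OF q])
    with sublinear_minus[OF q, of y] show ?thesis by linarith
  qed
  show ?thesis
  proof (rule linearI)
    \<comment> \<open>Since \<open>q\<close> is odd, subadditivity at \<open>- x\<close> and
      \<open>- y\<close> is superadditivity at \<open>x\<close> and \<open>y\<close>.\<close>
    show "q (x + y) = q x + q y" for x y
      using sublinear_add[OF q, of x y] sublinear_add[OF q, of "- x" "- y"] neg[of "x + y"]
      by (simp add: neg)
    show "q (c *\<^sub>R x) = c *\<^sub>R q x" for c x
    proof (cases "c \<ge> 0")
      case False
      then show ?thesis
        using neg[of "c *\<^sub>R x"] sublinear_scale[OF q, of "- c" x] by simp
    qed (simp add: sublinear_scale[OF q])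
  qed
qed

text \<open>Zorn's lemma supplies a minimal sublinear functional below \<open>p\<close>, and
  minimality makes it linear.\<close>

theorem sublinear_dominates_linear:
  fixes p :: "'a::real_vector \<Rightarrow> real"
  assumes p: "sublinear p"
  obtains \<phi> where "linear \<phi>" "\<And>x. \<phi> x \<le> p x"
proof -
  define S where "S = {q. sublinear q \<and> q \<le> p}"
  \<comment> \<open>The order is reversed, so a maximal element is a minimal functional and a chain
    is bounded by its pointwise infimum.\<close>
  have "\<exists>m\<in>S. \<forall>a\<in>S. a \<le> m \<longrightarrow> a = m"
  proof (rule predicate_Zorn)
    show "partial_order_on S (relation_of (\<lambda>a b. b \<le> a) S)"
      by (rule partial_order_on_relation_ofI) auto
  next
    fix C assume "C \<in> Chains (relation_of (\<lambda>a b. b \<le> a) S)"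
    then have CS: "C \<subseteq> S" and chain: "\<And>a b. a \<in> C \<Longrightarrow> b \<in> C \<Longrightarrow> a \<le> b \<or> b \<le> a"
      by (auto simp: Chains_def relation_of_def)
    show "\<exists>u\<in>S. \<forall>a\<in>C. u \<le> a"
    proof (cases "C = {}")
      case True
      then show ?thesis using p by (auto simp: S_def)
    next
      case False
      have C: "sublinear a" "a \<le> p" if "a \<in> C" for a
        using that CS by (auto simp: S_def)
      have lower: "- p (- x) \<le> a x" if "a \<in> C" for a x
        using sublinear_minus[OF C(1)[OF that], of x] le_funD[OF C(2)[OF that], of "- x"]
        by linarith
      define u where "u x = (INF a\<in>C. a x)" for x
      have "sublinear u"
        unfolding u_def[abs_def]
      proof (rule sublinear_INF[OF False lower])
        \<comment> \<open>In a chain the smaller of \<open>a\<close> and \<open>b\<close> serves for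
          both.\<close>
        fix a b x y assume ab: "a \<in> C" "b \<in> C"
        from chain[OF this] show "\<exists>k\<in>C. k (x + y) \<le> a x + b y"
        proof
          assume "a \<le> b"
          then show ?thesis
            using ab sublinear_add[OF C(1), of a x y]
            by (intro bexI[of _ a]) (auto dest: le_funD[of _ _ y])
        next
          assume "b \<le> a"
          then show ?thesis
            using ab sublinear_add[OF C(1), of b x y]
            by (intro bexI[of _ b]) (auto dest: le_funD[of _ _ x])
        qed
      next
        fix a x and c :: real assume "a \<in> C" "c > 0"
        then show "\<exists>k\<in>C. k (c *\<^sub>R x) \<le> c * a x"
          by (intro bexI[of _ a]) (auto simp: sublinear_scale[OF C(1)])
      next
        show "\<exists>a\<in>C. a 0 \<le> 0"
          using False C sublinear_zero by fastforce
      qed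
      moreover have ua: "u \<le> a" if "a \<in> C" for a
        unfolding u_def le_fun_def using that lower
        by (intro allI cINF_lower bdd_belowI2) auto
      moreover obtain a where "a \<in> C" using False by blast
      ultimately show ?thesis
        using order_trans[OF ua C(2)] by (intro bexI[of _ u]) (auto simp: S_def)
    qed
  qed
  then obtain m where m: "sublinear m" "m \<le> p"
    and min: "\<And>a. sublinear a \<Longrightarrow> a \<le> p \<Longrightarrow> a \<le> m \<Longrightarrow> a = m"
    by (auto simp: S_def)
  have "linear m"
    by (rule minimal_sublinear_linear[OF m(1)]) (rule min, auto intro: order_trans[OF _ m(2)])
  then show ?thesis using that m(2) by (auto simp: le_fun_def)
qed

text \<open>The one-sided bound, used at \<open>x\<close> and at \<open>- x\<close>, bounds the
  absolute value of the dominated linear functional and so makes it continuous.\<close>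

lemma bounded_sublinear_dominates_blinfun:
  fixes p :: "'a::real_normed_vector \<Rightarrow> real"
  assumes p: "sublinear p" and bound: "\<And>x. p x \<le> M * norm x"
  obtains u :: "'a \<Rightarrow>\<^sub>L real" where "\<And>x. blinfun_apply u x \<le> p x"
proof -
  obtain \<phi> where lin: "linear \<phi>" and le: "\<And>x. \<phi> x \<le> p x"
    using sublinear_dominates_linear[OF p] by blast
  have "norm (\<phi> x) \<le> norm x * M" for x
    using order_trans[OF le bound, of x] order_trans[OF le bound, of "- x"] linear_neg[OF lin, of x]
    by (simp add: mult.commute)
  then have "bounded_linear \<phi>"
    using lin by (intro bounded_linear.intro bounded_linear_axioms.intro) auto
  then show ?thesis
    using le that[of "Blinfun \<phi>"] by (simp add: bounded_linear_Blinfun_apply)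
qed

text \<open>With \<open>d\<close> the distance from \<open>x\<close> to \<open>C\<close>, the separating functional is one dominated by the
  sublinear functional \<open>z \<mapsto> inf\<^bsub>t \<ge> 0, c \<in> C\<^esub> (\<parallel>z + t (c - x)\<parallel> - t d)\<close>, whose value at \<open>x - c\<close> is
  at most \<open>- d\<close>.\<close>

theorem separate_point_closed_convex:
  fixes C :: "'a::real_normed_vector set"
  assumes "closed C" "convex C" "C \<noteq> {}" "x \<notin> C"
  obtains u :: "'a \<Rightarrow>\<^sub>L real" and d where "d > 0"
    "\<And>c. c \<in> C \<Longrightarrow> blinfun_apply u x + d \<le> blinfun_apply u c"
proof -
  define d where "d = infdist x C"
  have d: "d > 0"
    unfolding d_def using assms infdist_pos_not_in_closed by blast
  have dle: "d \<le> norm (c - x)" if "c \<in> C" for c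
    using infdist_le[OF that, of x] by (simp add: d_def dist_norm norm_minus_commute)
  define I where "I = {0::real..} \<times> C"
  define A where "A = (\<lambda>(t, c) z. norm (z + t *\<^sub>R (c - x)) - t * d)"
  define p where "p z = (INF i\<in>I. A i z)" for z
  have lower: "- norm z \<le> A i z" if i: "i \<in> I" for i z
  proof -
    obtain t c where tc: "i = (t, c)" "t \<ge> 0" "c \<in> C"
      using i by (auto simp: I_def)
    have "t * d \<le> norm (t *\<^sub>R (c - x))"
      using tc dle[of c] by (simp add: mult_left_mono)
    also have "\<dots> \<le> norm (z + t *\<^sub>R (c - x)) + norm z"
      using norm_triangle_ineq4[of "z + t *\<^sub>R (c - x)" z] by simp
    finally show ?thesis by (simp add: A_def tc)
  qed
  obtain c0 where c0: "c0 \<in> C" using assms by blast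
  have "sublinear p"
    unfolding p_def[abs_def]
  proof (rule sublinear_INF[OF _ lower])
    show "I \<noteq> {}" using c0 by (auto simp: I_def)
    show "\<exists>i\<in>I. A i 0 \<le> 0"
      using c0 by (intro bexI[of _ "(0, c0)"]) (auto simp: I_def A_def)
  next
    fix i z and a :: real assume "i \<in> I" and a: "a > 0"
    then obtain t c where tc: "i = (t, c)" "t \<ge> 0" "c \<in> C"
      by (auto simp: I_def)
    have "a *\<^sub>R z + (a * t) *\<^sub>R (c - x) = a *\<^sub>R (z + t *\<^sub>R (c - x))"
      by (simp add: scaleR_add_right)
    then have "norm (a *\<^sub>R z + (a * t) *\<^sub>R (c - x)) = a * norm (z + t *\<^sub>R (c - x))"
      using a by simp
    then have "A (a * t, c) (a *\<^sub>R z) = a * A i z"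
      by (simp add: A_def tc right_diff_distrib)
    moreover have "(a * t, c) \<in> I" using tc a by (simp add: I_def)
    ultimately show "\<exists>k\<in>I. A k (a *\<^sub>R z) \<le> a * A i z" by (metis order_refl)
  next
    fix i j z w assume "i \<in> I" "j \<in> I"
    then obtain s c t e where st: "i = (s, c)" "s \<ge> 0" "c \<in> C" "j = (t, e)" "t \<ge> 0" "e \<in> C"
      by (auto simp: I_def)
    \<comment> \<open>The pairs \<open>(t, c)\<close> parametrize the cone spanned by
      \<open>C - x\<close>. Convexity merges \<open>s (c - x) + t (e - x)\<close> into
      \<open>(s + t) (g - x)\<close> with the weighted mean \<open>g\<close>, which is defined only
      for \<open>s + t > 0\<close>.\<close>
    show "\<exists>k\<in>I. A k (z + w) \<le> A i z + A j w"
    proof (cases "s + t = 0")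
      case True
      then have "s = 0" "t = 0" using st by auto
      then show ?thesis
        using st norm_triangle_ineq[of z w]
        by (intro bexI[of _ "(0, c)"]) (auto simp: I_def A_def)
    next
      case False
      define g where "g = (s / (s + t)) *\<^sub>R c + (t / (s + t)) *\<^sub>R e"
      have "g \<in> C"
        unfolding g_def using False st \<open>convex C\<close>
        by (intro convexD) (auto simp: add_divide_distrib[symmetric])
      have "(s + t) *\<^sub>R g = s *\<^sub>R c + t *\<^sub>R e"
        using False by (simp add: g_def scaleR_add_right)
      then have "z + w + (s + t) *\<^sub>R (g - x) = (z + s *\<^sub>R (c - x)) + (w + t *\<^sub>R (e - x))"
        by (simp add: algebra_simps)
      then have "norm (z + w + (s + t) *\<^sub>R (g - x))
          \<le> norm (z + s *\<^sub>R (c - x)) + norm (w + t *\<^sub>R (e - x))"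
        by (metis norm_triangle_ineq)
      then have "A (s + t, g) (z + w) \<le> A i z + A j w"
        by (simp add: A_def st distrib_right)
      moreover have "(s + t, g) \<in> I" using st \<open>g \<in> C\<close> by (simp add: I_def)
      ultimately show ?thesis by blast
    qed
  qed
  moreover have le: "p z \<le> A i z" if "i \<in> I" for i z
    unfolding p_def using that lower by (intro cINF_lower bdd_belowI2) auto
  have "p z \<le> 1 * norm z" for z
    using le[of "(0, c0)" z] c0 by (simp add: A_def I_def)
  ultimately obtain u :: "'a \<Rightarrow>\<^sub>L real" where u: "\<And>z. blinfun_apply u z \<le> p z"
    using bounded_sublinear_dominates_blinfun by blast
  \<comment> \<open>With index \<open>(1, c)\<close> at the point \<open>x - c\<close> the norm
    vanishes and only \<open>- d\<close> remains.\<close>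
  have "blinfun_apply u x + d \<le> blinfun_apply u c" if "c \<in> C" for c
    using u[of "x - c"] le[of "(1, c)" "x - c"] that
    by (simp add: A_def I_def blinfun.diff_right)
  with d show ?thesis using that by blast
qed

section \<open>Decreasing sequences of closed convex sets in reflexive spaces\<close>

theorem reflexive_INT_decseq_nonempty:
  fixes C :: "nat \<Rightarrow> 'a::real_normed_vector set"
  assumes refl: "reflexive_space TYPE('a)"
    and dec: "decseq C" and bounded: "bounded (C 0)"
    and C: "\<And>n. closed (C n)" "\<And>n. convex (C n)" and ne: "\<And>n. C n \<noteq> {}"
  shows "(\<Inter>n. C n) \<noteq> {}"
proof -
  obtain M where "\<And>c. c \<in> C 0 \<Longrightarrow> norm c \<le> M"
    using bounded by (auto simp: bounded_iff)
  then have M: "norm c \<le> M" if "c \<in> C n" for n c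
    using that decseqD[OF dec, of 0 n] by auto
  have uM: "\<bar>blinfun_apply u c\<bar> \<le> M * norm u" if "c \<in> C n" for n u c
  proof -
    have "\<bar>blinfun_apply u c\<bar> \<le> norm u * norm c"
      using norm_blinfun[of u c] by simp
    also have "\<dots> \<le> norm u * M"
      using M[OF that] by (rule mult_left_mono) simp
    finally show ?thesis by (simp add: mult.commute)
  qed
  define A :: "nat \<Rightarrow> ('a \<Rightarrow>\<^sub>L real) \<Rightarrow> real"
    where "A n u = (SUP c\<in>C n. blinfun_apply u c)" for n u
  define p where "p u = (INF n. A n u)" for u
  have upper: "blinfun_apply u c \<le> A n u" if "c \<in> C n" for n u c
    unfolding A_def using that uM by (intro cSUP_upper bdd_aboveI2) (auto simp: abs_le_iff)
  have least: "A n u \<le> m" if "\<And>c. c \<in> C n \<Longrightarrow> blinfun_apply u c \<le> m" for n u m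
    unfolding A_def using ne that by (rule cSUP_least)
  have lower: "- (M * norm u) \<le> A n u" for n u
  proof -
    obtain c where c: "c \<in> C n" using ne by blast
    show ?thesis using uM[OF c, of u] upper[OF c, of u] by linarith
  qed
  have "sublinear p"
    unfolding p_def[abs_def]
  proof (rule sublinear_INF[OF _ lower])
    fix m n u v
    \<comment> \<open>The later set is contained in both \<open>C m\<close> and \<open>C n\<close>,
      so both suprema bound its points.\<close>
    have "A (max m n) (u + v) \<le> A m u + A n v"
    proof (rule least)
      fix c assume "c \<in> C (max m n)"
      then have "c \<in> C m" "c \<in> C n"
        using decseqD[OF dec, of m "max m n"] decseqD[OF dec, of n "max m n"] by auto
      then show "blinfun_apply (u + v) c \<le> A m u + A n v"
        using upper[of c m u] upper[of c n v] by (simp add: blinfun.add_left)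
    qed
    then show "\<exists>k\<in>UNIV. A k (u + v) \<le> A m u + A n v" by blast
  next
    fix n u and a :: real assume "a > 0"
    then have "A n (a *\<^sub>R u) \<le> a * A n u"
      by (intro least) (auto simp: blinfun.scaleR_left intro!: mult_left_mono upper)
    then show "\<exists>k\<in>UNIV. A k (a *\<^sub>R u) \<le> a * A n u" by blast
  next
    show "\<exists>n\<in>UNIV. A n 0 \<le> 0" using least[of 0 0 0] by auto
  qed auto
  moreover have le: "p u \<le> A n u" for n u
    unfolding p_def using lower by (intro cINF_lower bdd_belowI2) auto
  \<comment> \<open>This bound places the dominated functional in the bidual, where reflexivity
    represents it by a point.\<close>
  have "p u \<le> M * norm u" for u
    using le[of u 0] least[of 0 u "M * norm u"] uM[of _ 0 u] by (force simp: abs_le_iff)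
  ultimately obtain \<phi> :: "('a \<Rightarrow>\<^sub>L real) \<Rightarrow>\<^sub>L real" where \<phi>: "\<And>u. blinfun_apply \<phi> u \<le> p u"
    using bounded_sublinear_dominates_blinfun by blast
  obtain x where x: "\<phi> = bidual_embedding x"
    using refl by (auto simp: reflexive_space_def)
  \<comment> \<open>A point outside \<open>C n\<close> would be separated from it by some
    \<open>u\<close>; then the supremum of \<open>- u\<close> over \<open>C n\<close> lies below
    \<open>- u x\<close>, against \<open>\<phi> \<le> p \<le> A n\<close>.\<close>
  have "x \<in> C n" for n
  proof (rule ccontr)
    assume "x \<notin> C n"
    then obtain u :: "'a \<Rightarrow>\<^sub>L real" and d where d: "d > 0"
      and u: "\<And>c. c \<in> C n \<Longrightarrow> blinfun_apply u x + d \<le> blinfun_apply u c"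
      using separate_point_closed_convex[OF C ne] by blast
    have "A n (- u) \<le> - blinfun_apply u x - d"
      using u by (intro least) (force simp: blinfun.minus_left)
    moreover have "- blinfun_apply u x \<le> A n (- u)"
      using order_trans[OF \<phi>[of "- u"] le[of "- u" n]] by (simp add: x blinfun.minus_left)
    ultimately show False using d by linarith
  qed
  then show ?thesis by blast
qed

section \<open>The minimal time function\<close>

lemma minimal_time_le:
  assumes "t \<ge> 0" "f \<in> F" "x + t *\<^sub>R f \<in> Q"
  shows "minimal_time F Q x \<le> ereal t"
  unfolding minimal_time_def using assms by (intro Inf_lower) blast

lemma minimal_time_nonneg: "0 \<le> minimal_time F Q x"
  unfolding minimal_time_def by (rule Inf_greatest) auto

lemma minimal_time_less_obtain:
  assumes "minimal_time F Q x < ereal s"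
  obtains t f where "0 \<le> t" "t < s" "f \<in> F" "x + t *\<^sub>R f \<in> Q"
  using assms unfolding minimal_time_def by (auto simp: Inf_less_iff)

text \<open>From \<open>x - s f\<close> one can reach \<open>x\<close> in time \<open>s\<close>
  along \<open>f\<close> and then continue along \<open>g\<close> for time \<open>t\<close>.
  Convexity of \<open>F\<close> replaces the two legs by one direction \<open>h\<close> with
  duration \<open>s + t\<close>.\<close>

lemma minimal_time_diff_scaleR_le:
  assumes "convex F" "f \<in> F" "s \<ge> 0"
  shows "minimal_time F Q (x - s *\<^sub>R f) \<le> minimal_time F Q x + ereal s"
proof -
  have le: "minimal_time F Q (x - s *\<^sub>R f) \<le> ereal (s + t)"
    if t: "t \<ge> 0" "g \<in> F" "x + t *\<^sub>R g \<in> Q" for t g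
  proof (cases "s + t = 0")
    case True
    then have "s = 0" "t = 0" using t assms by auto
    then show ?thesis using t minimal_time_le[of 0 g F x Q] by simp
  next
    case False
    define h where "h = (s / (s + t)) *\<^sub>R f + (t / (s + t)) *\<^sub>R g"
    have "h \<in> F"
      unfolding h_def using False t assms
      by (intro convexD) (auto simp: add_divide_distrib[symmetric])
    moreover have "(s + t) *\<^sub>R h = s *\<^sub>R f + t *\<^sub>R g"
      using False by (simp add: h_def scaleR_add_right)
    then have "x - s *\<^sub>R f + (s + t) *\<^sub>R h \<in> Q" using t by simp
    ultimately show ?thesis using t assms by (intro minimal_time_le) auto
  qed
  have "minimal_time F Q (x - s *\<^sub>R f) - ereal s \<le> minimal_time F Q x"
    unfolding minimal_time_def[of F Q x]
  proof (rule Inf_greatest)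
    fix a assume "a \<in> {ereal t |t. 0 \<le> t \<and> (\<lambda>f. x + t *\<^sub>R f) ` F \<inter> Q \<noteq> {}}"
    then obtain t g where "a = ereal t" "t \<ge> 0" "g \<in> F" "x + t *\<^sub>R g \<in> Q" by blast
    then show "minimal_time F Q (x - s *\<^sub>R f) - ereal s \<le> a"
      using le[of t g] by (simp add: ereal_minus_le_iff add.commute)
  qed
  then show ?thesis by (simp add: ereal_minus_le_iff add.commute)
qed

lemma minimal_time_pos:
  fixes F Q :: "'a::real_normed_vector set"
  assumes refl: "reflexive_space TYPE('a)"
    and F: "closed F" "convex F" "0 \<in> F"
    and Q: "closed Q" "bounded Q" "convex Q"
    and x: "x \<notin> {q - d | q d. q \<in> Q \<and> d \<in> asymptotic_cone F}"
  shows "minimal_time F Q x > 0"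
proof (rule ccontr)
  assume "\<not> minimal_time F Q x > 0"
  then have T0: "minimal_time F Q x = 0"
    using minimal_time_nonneg[of F Q x] by simp
  have shrink: "a *\<^sub>R f \<in> F" if "f \<in> F" "0 \<le> a" "a \<le> 1" for a f
    using convexD[OF F(2) that(1) F(3), of a "1 - a"] that by simp
  \<comment> \<open>This is \<open>x + F / (n + 1)\<close>, written as a preimage so that closedness
    follows from continuity; \<open>Suc n\<close> avoids a zero factor.\<close>
  define G where "G n = (\<lambda>q. real (Suc n) *\<^sub>R (q - x)) -` F" for n
  define C where "C n = Q \<inter> G n" for n
  have clG: "closed (G n)" for n
    unfolding G_def by (intro closed_vimage F(1) continuous_intros)
  have cvG: "convex (G n)" for n
  proof (rule convexI)
    fix y z and a b :: real
    assume yz: "y \<in> G n" "z \<in> G n" and ab: "0 \<le> a" "0 \<le> b" "a + b = 1"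
    have "x = a *\<^sub>R x + b *\<^sub>R x" using ab by (simp flip: scaleR_add_left)
    then have "a *\<^sub>R y + b *\<^sub>R z - x = a *\<^sub>R (y - x) + b *\<^sub>R (z - x)"
      by (simp add: algebra_simps)
    then have "real (Suc n) *\<^sub>R (a *\<^sub>R y + b *\<^sub>R z - x)
        = a *\<^sub>R (real (Suc n) *\<^sub>R (y - x)) + b *\<^sub>R (real (Suc n) *\<^sub>R (z - x))"
      by (simp add: scaleR_add_right mult.commute del: of_nat_Suc)
    also have "\<dots> \<in> F" using yz ab F(2) unfolding G_def by (intro convexD) auto
    finally show "a *\<^sub>R y + b *\<^sub>R z \<in> G n" by (simp add: G_def)
  qed
  have "(\<Inter>n. C n) \<noteq> {}"
  proof (rule reflexive_INT_decseq_nonempty[OF refl])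
    show "decseq C"
    proof (rule decseq_SucI, rule subsetI)
      fix n q assume q: "q \<in> C (Suc n)"
      have "(real (Suc n) / real (Suc (Suc n))) *\<^sub>R (real (Suc (Suc n)) *\<^sub>R (q - x)) \<in> F"
      proof (rule shrink)
        show "real (Suc (Suc n)) *\<^sub>R (q - x) \<in> F" using q by (simp add: C_def G_def)
      qed auto
      then show "q \<in> C n" using q by (simp add: C_def G_def del: of_nat_Suc)
    qed
    show "bounded (C 0)" using Q by (auto simp: C_def intro: bounded_subset)
    show "closed (C n)" for n using Q clG by (auto simp: C_def)
    show "convex (C n)" for n using Q cvG by (auto simp: C_def intro: convex_Int)
    show "C n \<noteq> {}" for n
    proof -
      \<comment> \<open>A time \<open>t\<close> below \<open>1 / (n + 1)\<close> makes
        \<open>(n + 1) t\<close> a shrinking factor, so the point reached lies in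
        \<open>C n\<close>.\<close>
      have "minimal_time F Q x < ereal (1 / real (Suc n))" using T0 by simp
      then obtain t f where t: "0 \<le> t" "t < 1 / real (Suc n)" "f \<in> F" "x + t *\<^sub>R f \<in> Q"
        by (rule minimal_time_less_obtain)
      have "(real (Suc n) * t) *\<^sub>R f \<in> F"
        using t by (intro shrink) (auto simp: field_simps)
      then have "x + t *\<^sub>R f \<in> C n" using t by (simp add: C_def G_def)
      then show ?thesis by blast
    qed
  qed
  then obtain q where q: "q \<in> Q" "\<And>n. real (Suc n) *\<^sub>R (q - x) \<in> F"
    by (auto simp: C_def G_def simp del: of_nat_Suc)
  have "t *\<^sub>R (q - x) \<in> F" if "t > 0" for t
  proof -
    \<comment> \<open>An integer multiple beyond \<open>t\<close> is available in \<open>F\<close>;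
      shrinking it towards \<open>0\<close> gives the multiple \<open>t\<close>.\<close>
    obtain n where n: "t < real (Suc n)"
      using reals_Archimedean2[of t] by (metis less_SucI of_nat_less_iff order_less_trans lessI)
    have "(t / real (Suc n)) *\<^sub>R (real (Suc n) *\<^sub>R (q - x)) \<in> F"
      using n that by (intro shrink q(2)) (auto simp: divide_simps)
    then show ?thesis by (simp del: of_nat_Suc)
  qed
  then have "q - x \<in> asymptotic_cone F"
    using F(3) by (auto simp: asymptotic_cone_def intro!: bexI[of _ 0])
  moreover have "x = q - (q - x)" by simp
  ultimately show False using x q(1) by blast
qed

section \<open>Subgradients, level sets and the support function\<close>

lemma support_fun_le_iff:
  "support_fun F u \<le> ereal a \<longleftrightarrow> (\<forall>f\<in>F. blinfun_apply u f \<le> a)"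
  by (simp add: support_fun_def SUP_le_iff)

theorem theorem4p3:
  fixes F Q :: "'a::banach set" and xbar :: 'a and r :: real
  assumes "reflexive_space TYPE('a)"
    and "closed F" and "convex F" and "0 \<in> F"
    and "Q \<noteq> {}" and "closed Q" and "bounded Q" and "convex Q"
    and "xbar \<notin> {q - d | q d. q \<in> Q \<and> d \<in> asymptotic_cone F}"
    and "minimal_time F Q xbar < \<infinity>"
    and "r = real_of_ereal (minimal_time F Q xbar)"
  shows "r > 0 \<and>
    subdifferential (minimal_time F Q) xbar = normal_cone xbar (enlargement F Q r) \<inter> S_star F"
proof -
  let ?T = "minimal_time F Q"
  have Tpos: "?T xbar > 0"
    using assms by (intro minimal_time_pos)
  then have Tr: "?T xbar = ereal r"
    using assms(10,11) by (cases "?T xbar") auto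
  with Tpos have r: "r > 0" by simp
  have "u \<in> normal_cone xbar (enlargement F Q r) \<inter> S_star F"
    if u: "u \<in> subdifferential ?T xbar" for u
  proof
    have u: "ereal (blinfun_apply u (x - xbar)) + ereal r \<le> ?T x" for x
      using u by (auto simp: subdifferential_def Tr ereal_le_minus_iff)
    show "u \<in> normal_cone xbar (enlargement F Q r)"
      unfolding normal_cone_def enlargement_def
    proof (intro CollectI ballI)
      fix x assume "x \<in> {x. ?T x \<le> ereal r}"
      then have "ereal (blinfun_apply u (x - xbar) + r) \<le> ereal r"
        using order_trans[OF u[of x], of "ereal r"] by simp
      then show "blinfun_apply u (x - xbar) \<le> 0" by simp
    qed
    have "support_fun F (- u) \<le> ereal 1"
      unfolding support_fun_le_iff
    proof
      \<comment> \<open>The subgradient inequality is tested at \<open>xbar - f\<close>, where the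
        time is at most \<open>r + 1\<close>.\<close>
      fix f assume f: "f \<in> F"
      show "blinfun_apply (- u) f \<le> 1"
        using order_trans[OF u minimal_time_diff_scaleR_le[OF assms(3) f, of 1 Q xbar]]
        by (simp add: Tr blinfun.minus_left blinfun.minus_right)
    qed
    moreover have "1 \<le> support_fun F (- u)"
    proof (rule ccontr)
      assume "\<not> 1 \<le> support_fun F (- u)"
      then obtain a where a: "support_fun F (- u) < ereal a" "ereal a < 1"
        using ereal_dense2[of "support_fun F (- u)" 1] by (auto simp: not_le)
      have a0: "0 \<le> a"
        using a(1) assms(4) support_fun_le_iff[of F "- u" a] by force
      \<comment> \<open>As \<open>a < 1\<close>, a time bound \<open>s\<close> slightly above
        \<open>r\<close> still has \<open>a s < r\<close>. The case \<open>a = 0\<close> is separate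
        because the choice \<open>s < r / a\<close> divides by \<open>a\<close>.\<close>
      have "\<exists>s>r. a * s < r"
      proof (cases "a = 0")
        case True
        then show ?thesis using r by (intro exI[of _ "r + 1"]) auto
      next
        case False
        then have "r < r / a" using a a0 r by (simp add: field_simps)
        then obtain s where "r < s" "s < r / a" using dense by blast
        then show ?thesis using a0 False by (intro exI[of _ s]) (auto simp: field_simps)
      qed
      then obtain s where s: "r < s" "a * s < r" by blast
      then obtain t f where t: "0 \<le> t" "t < s" "f \<in> F" "xbar + t *\<^sub>R f \<in> Q"
        using minimal_time_less_obtain[of F Q xbar s] Tr by (metis ereal_less_eq(3) not_le)
      \<comment> \<open>The endpoint of a near-optimal path lies in \<open>Q\<close>. Testing the
        subgradient there gives \<open>r \<le> - t u f \<le> t a \<le> a s < r\<close>.\<close>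
      have "?T (xbar + t *\<^sub>R f) \<le> ereal 0"
        using t by (intro minimal_time_le[of _ f]) auto
      then have "ereal (blinfun_apply u (t *\<^sub>R f)) + ereal r \<le> ereal 0"
        using order_trans[OF u[of "xbar + t *\<^sub>R f"], of "ereal 0"] by simp
      then have "r \<le> t * (- blinfun_apply u f)" by (simp add: blinfun.scaleR_right)
      also have "- blinfun_apply u f \<le> a"
        using a(1) support_fun_le_iff[of F "- u" a] t by (auto simp: blinfun.minus_left)
      then have "t * (- blinfun_apply u f) \<le> t * a" using t by (intro mult_left_mono)
      also have "t * a \<le> a * s" using t a0 by (simp add: mult.commute mult_left_mono)
      finally show False using s by simp
    qed
    ultimately show "u \<in> S_star F" by (simp add: S_star_def flip: one_ereal_def)
  qed
  moreover have "u \<in> subdifferential ?T xbar"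
    if N: "u \<in> normal_cone xbar (enlargement F Q r)" and S: "u \<in> S_star F" for u
  proof -
    have N: "blinfun_apply u (x - xbar) \<le> 0" if "?T x \<le> ereal r" for x
      using N that by (auto simp: normal_cone_def enlargement_def)
    have S1: "support_fun F (- u) = ereal 1"
      using S by (simp add: S_star_def one_ereal_def)
    have uf: "- blinfun_apply u f \<le> 1" if "f \<in> F" for f
      using S1 support_fun_le_iff[of F "- u" 1] that by (auto simp: blinfun.minus_left)
    have "ereal (blinfun_apply u (x - xbar)) + ereal r \<le> ?T x" for x
    proof (cases "?T x \<le> ereal r")
      case True
      then obtain t where t: "?T x = ereal t" "t \<le> r"
        using minimal_time_nonneg[of F Q x] by (cases "?T x") auto
      \<comment> \<open>Moving backwards by \<open>(r - t) f\<close> uses up the spare time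
        \<open>r - t\<close> and stays in the level set, where the normal cone inequality
        applies.\<close>
      have le: "blinfun_apply u (x - xbar) \<le> (r - t) * blinfun_apply u f" if f: "f \<in> F" for f
      proof -
        have "?T (x - (r - t) *\<^sub>R f) \<le> ereal r"
          using minimal_time_diff_scaleR_le[OF assms(3) f, of "r - t" Q x] t by simp
        from N[OF this] show ?thesis
          by (simp add: blinfun.diff_right blinfun.scaleR_right)
      qed
      have "blinfun_apply u (x - xbar) \<le> t - r"
      proof (cases "t = r")
        case True
        then show ?thesis using le[OF assms(4)] by simp
      next
        case False
        then have rt: "r - t > 0" using t by simp
        \<comment> \<open>Dividing \<open>le\<close> by \<open>r - t\<close> bounds
          \<open>- u f\<close> uniformly in \<open>f\<close>. As the supremum equals
          \<open>1\<close>, the bound is at least \<open>1\<close>, which is the claim; it need not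
          be attained.\<close>
        have "support_fun F (- u) \<le> ereal (- blinfun_apply u (x - xbar) / (r - t))"
          unfolding support_fun_le_iff using le rt
          by (auto simp: blinfun.minus_left field_simps)
        then show ?thesis using rt by (simp add: S1 field_simps)
      qed
      then show ?thesis by (simp add: t)
    next
      case False
      show ?thesis
        unfolding minimal_time_def[of F Q x]
      proof (rule Inf_greatest)
        fix a assume "a \<in> {ereal t |t. 0 \<le> t \<and> (\<lambda>f. x + t *\<^sub>R f) ` F \<inter> Q \<noteq> {}}"
        then obtain t f where t: "a = ereal t" "t \<ge> 0" "f \<in> F" "x + t *\<^sub>R f \<in> Q" by blast
        have "ereal r < ereal t"
          using False minimal_time_le[OF t(2-4)] by (meson less_le_trans not_le)
        then have rt: "r < t" by simp
        \<comment> \<open>After time \<open>t - r\<close> on the path to \<open>Q\<close> only time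
          \<open>r\<close> remains, so this point lies in the level set; the first leg costs at most
          \<open>t - r\<close> because \<open>- u f \<le> 1\<close>.\<close>
        have "?T (x + (t - r) *\<^sub>R f) \<le> ereal r"
          using t r by (intro minimal_time_le[of _ f]) (auto simp: algebra_simps)
        from N[OF this] have "blinfun_apply u (x - xbar) \<le> (t - r) * (- blinfun_apply u f)"
          by (simp add: blinfun.diff_right blinfun.add_right blinfun.scaleR_right)
        also have "\<dots> \<le> (t - r) * 1"
          using uf[OF t(3)] rt by (intro mult_left_mono) auto
        finally show "ereal (blinfun_apply u (x - xbar)) + ereal r \<le> a" by (simp add: t)
      qed
    qed
    then show ?thesis by (auto simp: subdifferential_def Tr ereal_le_minus_iff)
  qed
  ultimately show ?thesis using r by blast
qed

end
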